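(* Let $n$ be a natural number with $n\ge 27$ and let $\alpha\in(0,1)$. Then $$A_{2n-1}(\alpha,1)\ \ge\ |A_{2n-1}(\alpha,e^{i\theta})|\qquad\text{for all }\theta\in\left[-\pi,-\tfrac{2\pi}{3}\right]\cup\left[\tfrac{2\pi}{3},\pi\right],$$ where $A_m(\alpha,x)$ denotes the coefficient of $z^m$ in the Maclaurin expansion of $\frac{(1+xz)^\alpha}{1-z}$.
   Context: For $\alpha>0$ and $x\in\mathbb{C}$ with $|x|=1$, the coefficients $A_m(\alpha,x)$ are defined by $$\frac{(1+xz)^\alpha}{1-z}=\sum_{m=0}^\infty A_m(\alpha,x)z^m,\qquad |z|<1,$$ with the principal branch of the power (value $1$ at $z=0$). Equivalently, $A_m(\alpha,x)=\sum_{k=0}^{m}\frac{\alpha(\alpha-1)\cdots(\alpha-k+1)}{k!}x^k$. *)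

theory Defs
  imports "HOL-Complex_Analysis.Complex_Analysis"
begin

(* Complex powr is the principal branch, so the expanded function is 1 at z = 0
   and holomorphic near 0 (on the whole unit disc when cmod x = 1). *)
definition A_coeff :: "nat \<Rightarrow> real \<Rightarrow> complex \<Rightarrow> complex" where
  "A_coeff m \<alpha> x =
     fps_nth (fps_expansion (\<lambda>z. (1 + x * z) powr complex_of_real \<alpha> / (1 - z)) 0) m"

lemma A_coeff_eq_sum: "A_coeff m \<alpha> x = (\<Sum>k\<le>m. (complex_of_real \<alpha> gchoose k) * x ^ k)"
proof -
  let ?a = "complex_of_real \<alpha>"
  let ?B = "fps_binomial ?a oo (fps_const x * fps_X)"
  let ?G = "inverse (1 - fps_X) :: complex fps"
  let ?f = "\<lambda>z. (1 + x * z) powr ?a / (1 - z)"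
  have X: "(\<lambda>z. x * z) has_fps_expansion fps_const x * fps_X"
    by (rule has_fps_expansion_schematicI[OF has_fps_expansion_mult[OF
          has_fps_expansion_const has_fps_expansion_fps_X]]) auto
  have B: "(\<lambda>z. (1 + x * z) powr ?a) has_fps_expansion ?B"
    using has_fps_expansion_compose[OF has_fps_expansion_binomial_complex[of ?a] X]
    by (simp add: o_def)
  have G: "(\<lambda>z. inverse (1 - z :: complex)) has_fps_expansion ?G"
    by (auto intro!: fps_expansion_intros)
  have "?f has_fps_expansion (?B * ?G)"
    using has_fps_expansion_mult[OF B G] by (simp add: divide_inverse)
  hence "A_coeff m \<alpha> x = fps_nth (?B * ?G) m"
    by (simp add: A_coeff_def fps_expansion_def fps_nth_fps_expansion)
  also have "?G = Abs_fps (\<lambda>_. 1)"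
    by (metis fps_inverse_gp' fps_inverse_idempotent fps_nth_Abs_fps zero_neq_one)
  also have "fps_nth (?B * Abs_fps (\<lambda>_. 1)) m = (\<Sum>k\<le>m. (?a gchoose k) * x ^ k)"
    by (simp add: fps_mult_nth atMost_atLeast0 mult.commute[of _ "x ^ _"])
  finally show ?thesis .
qed

end

(* Put t = |1 + x|, which is at most 1 on the given arcs, and m = 2n - 1 >= 53.
   At x = 1 the series alternates and is cut after a positive term, so A_m(1) >= 2^a.
   For the other side let P be the product of 1 - a/k over k = 1..m.  Comparing with
   x = -1, where A_m(-1) = P, gives |A_m(x)| <= P + a m t, and summation by parts on the
   tail of the binomial series gives |A_m(x)| <= t^a + 2 a P / ((m + 1) t).  If
   (m + 1) t <= 13/6 - a/2, the first bound is at most 1 + 2a/3 <= 1 + a ln 2 <= 2^a;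
   otherwise concavity of t^a bounds the second one by 2^a. *)

theory Submission
  imports Defs
begin

section \<open>Binomial coefficients as signed products\<close>

text \<open>The product of \<open>1 - a / k\<close> over \<open>1 \<le> k \<le> m\<close>, which is also the sum of
  \<open>\<bar>a gchoose k\<bar>\<close> over \<open>k > m\<close> when \<open>0 < a < 1\<close>.\<close>

definition binom_tail :: "real \<Rightarrow> nat \<Rightarrow> real" where
  "binom_tail a m = (-1) ^ m * (a - 1 gchoose m)"

lemma binom_tail_Suc: "binom_tail a (Suc m) = binom_tail a m * (1 - a / (real m + 1))"
proof -
  have "(a - 1 gchoose Suc m) = (a - 1 - real m) / (real m + 1) * (a - 1 gchoose m)"
    using gbinomial_mult_1[of "a - 1" m] by (simp add: field_simps)
  moreover have "1 - a / (real m + 1) = - ((a - 1 - real m) / (real m + 1))"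
    by (simp add: field_simps)
  ultimately show ?thesis
    by (simp add: binom_tail_def)
qed

lemma binom_tail_pos: "a < 1 \<Longrightarrow> binom_tail a m > 0"
proof (induction m)
  case 0
  then show ?case by (simp add: binom_tail_def)
next
  case (Suc m)
  then have "a / (real m + 1) < 1" by (simp add: field_simps)
  with Suc show ?case by (simp add: binom_tail_Suc)
qed

lemma binom_tail_antimono:
  assumes "0 < a" "a < 1" "k \<le> m"
  shows "binom_tail a m \<le> binom_tail a k"
  using assms(3)
proof (induction m rule: dec_induct)
  case (step m)
  have "binom_tail a (Suc m) \<le> binom_tail a m * 1"
    unfolding binom_tail_Suc using assms binom_tail_pos[of a m]
    by (intro mult_left_mono) auto
  with step show ?case by simp
qed simp

lemma binom_tail_le:
  assumes "0 < a" "a < 1" "2 \<le> m"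
  shows "binom_tail a m \<le> (1 - a) * (1 - a / 2)"
  using binom_tail_antimono[OF assms]
  by (simp add: numeral_2_eq_2 binom_tail_Suc) (simp add: binom_tail_def)

text \<open>Absorption, (k + 1) C(a, k + 1) = a C(a - 1, k), isolates the sign. For 0 < a < 1 the
  remaining factor is positive and decreasing in k, which drives every later estimate of the
  series.\<close>

lemma gbinomial_Suc_eq_binom_tail:
  "(a gchoose Suc k) = (-1) ^ k * (a / (real k + 1) * binom_tail a k)"
  using gbinomial_absorption[of k a] by (simp add: binom_tail_def field_simps)

section \<open>Partial sums compared with their value at -1\<close>

definition binom_sum :: "real \<Rightarrow> nat \<Rightarrow> complex \<Rightarrow> complex" where
  "binom_sum a m x = (\<Sum>k\<le>m. of_real (a gchoose k) * x ^ k)"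

lemma of_real_gbinomial: "(complex_of_real a gchoose k) = of_real (a gchoose k)"
  by (simp add: gbinomial_prod_rev)

lemma A_coeff_eq_binom_sum: "A_coeff m a x = binom_sum a m x"
  by (simp add: A_coeff_eq_sum binom_sum_def of_real_gbinomial)

lemma binom_sum_minus_one: "binom_sum a m (-1) = of_real (binom_tail a m)"
proof -
  have "binom_sum a m (-1) = of_real (\<Sum>k\<le>m. (a gchoose k) * (-1) ^ k)"
    by (simp add: binom_sum_def)
  then show ?thesis
    by (simp only: gbinomial_sum_lower_neg binom_tail_def)
qed

text \<open>For k >= 1 the k-th coefficient has modulus at most a / k, while |x^k - (-1)^k| <= k |1
  + x| on the unit circle. The factor k cancels, so each of the m terms costs at most a |1 +
  x|.\<close>

lemma norm_binom_sum_le_near: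
  assumes a: "0 < a" "a < 1" and x: "norm x = 1"
  shows "norm (binom_sum a m x) \<le> binom_tail a m + a * real m * norm (1 + x)"
proof -
  have summand: "norm (of_real (a gchoose k) * (x ^ k - (-1) ^ k)) \<le> (if k = 0 then 0 else a * norm (1 + x))"
    for k
  proof (cases k)
    case (Suc j)
    have s: "binom_tail a j \<le> 1" "binom_tail a j > 0"
      using binom_tail_antimono[of a 0 j] binom_tail_pos[of a j] a by (auto simp: binom_tail_def)
    have c: "\<bar>a gchoose k\<bar> = a / (real j + 1) * binom_tail a j"
      using a s by (simp add: Suc gbinomial_Suc_eq_binom_tail abs_mult)
    have "norm (of_real (a gchoose k) * (x ^ k - (-1) ^ k))
        \<le> (a / (real j + 1) * binom_tail a j) * (real k * norm (x - (-1)))"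
      unfolding norm_mult norm_of_real c using a s x
      by (intro mult_mono norm_power_diff) auto
    also have "\<dots> = a * binom_tail a j * norm (1 + x)"
      by (simp add: Suc field_simps)
    also have "\<dots> \<le> a * 1 * norm (1 + x)"
      using a s by (intro mult_right_mono mult_left_mono) auto
    finally show ?thesis by (simp add: Suc)
  qed auto
  have "norm (binom_sum a m x - binom_sum a m (-1))
      = norm (\<Sum>k\<le>m. of_real (a gchoose k) * (x ^ k - (-1) ^ k))"
    by (simp add: binom_sum_def sum_subtractf right_diff_distrib)
  also have "\<dots> \<le> (\<Sum>k\<le>m. if k = 0 then 0 else a * norm (1 + x))"
    by (rule sum_norm_le) (rule summand)
  also have "\<dots> = a * real m * norm (1 + x)"
    by (simp add: sum.atMost_shift)
  finally have "norm (binom_sum a m x - binom_sum a m (-1)) \<le> a * real m * norm (1 + x)" .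
  moreover have "norm (binom_sum a m (-1)) = binom_tail a m"
    using binom_tail_pos[of a m] a by (simp add: binom_sum_minus_one)
  ultimately show ?thesis
    using norm_triangle_sub[of "binom_sum a m x" "binom_sum a m (-1)"] by linarith
qed

section \<open>The tail of the series away from -1\<close>

lemma norm_binom_sum_diff_le:
  assumes a: "0 < a" "a < 1" and x: "norm x \<le> 1" and "m \<le> N"
  shows "norm ((1 + x) * (binom_sum a N x - binom_sum a m x))
    \<le> 2 * (a / (real m + 1) * binom_tail a m)"
proof -
  \<comment> \<open>Summation by parts: \<open>b\<close> is decreasing, so its total variation from \<open>m\<close> on is at most \<open>b m\<close>.\<close>
  define b where "b k = a / (real k + 1) * binom_tail a k" for k
  have b0: "b k \<ge> 0" for k
    unfolding b_def using a binom_tail_pos[of a k] by simp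
  have bdec: "b (Suc k) \<le> b k" for k
    unfolding b_def using a binom_tail_pos[of a "Suc k"] binom_tail_antimono[of a k "Suc k"]
    by (intro mult_mono divide_left_mono) auto
  have xp: "norm ((- x) ^ k) \<le> 1" for k
    using x by (simp add: norm_power power_le_one)
  \<comment> \<open>Removing the boundary term makes the induction close: passing from N to N + 1
    then adds only (b N - b (N + 1)) (-x)^(N + 2). Restoring that term costs b N, which brings the
    bound to 2 b m.\<close>
  have "norm ((1 + x) * (binom_sum a N x - binom_sum a m x) - of_real (b N) * (- x) ^ Suc N)
    \<le> 2 * b m - b N"
    using \<open>m \<le> N\<close>
  proof (induction N rule: dec_induct)
    case base
    show ?case
      using b0[of m] xp[of "Suc m"] mult_left_mono[of "norm ((- x) ^ Suc m)" 1 "b m"]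
      by (simp add: norm_mult)
  next
    case (step N)
    have S: "binom_sum a (Suc N) x = binom_sum a N x - of_real (b N) * (- x) ^ Suc N"
      by (simp add: binom_sum_def gbinomial_Suc_eq_binom_tail b_def power_minus[of x])
    have eq: "(1 + x) * (binom_sum a (Suc N) x - binom_sum a m x) - of_real (b (Suc N)) * (- x) ^ Suc (Suc N)
      = ((1 + x) * (binom_sum a N x - binom_sum a m x) - of_real (b N) * (- x) ^ Suc N)
        + of_real (b N - b (Suc N)) * (- x) ^ Suc (Suc N)"
      unfolding S by (simp add: algebra_simps)
    have "norm (of_real (b N - b (Suc N)) * (- x) ^ Suc (Suc N)) \<le> (b N - b (Suc N)) * 1"
      unfolding norm_mult using bdec[of N] xp[of "Suc (Suc N)"]
      by (intro mult_mono) (auto simp del: of_real_diff)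
    from norm_triangle_mono[OF step.IH this] show ?case
      unfolding eq by simp
  qed
  moreover have "norm (of_real (b N) * (- x) ^ Suc N) \<le> b N * 1"
    unfolding norm_mult using b0[of N] xp[of "Suc N"] by (intro mult_mono) auto
  ultimately have "norm ((1 + x) * (binom_sum a N x - binom_sum a m x)) \<le> 2 * b m"
    by (smt (verit) norm_triangle_sub)
  then show ?thesis by (simp add: b_def)
qed

lemma binom_sum_tendsto:
  assumes "norm x < 1"
  shows "(\<lambda>N. binom_sum a N x) \<longlonglongrightarrow> (1 + x) powr of_real a"
  using gen_binomial_complex[OF assms, of "of_real a"]
  by (simp add: sums_def_le binom_sum_def of_real_gbinomial)

text \<open>The tail bound is uniform in N, so N can tend to infinity where the series converges to
  the power. Keeping the factor 1 + x avoids a division until the boundary is reached.\<close>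

lemma norm_binom_sum_mult_le_disc:
  assumes a: "0 < a" "a < 1" and x: "norm x < 1"
  shows "norm ((1 + x) * binom_sum a m x)
    \<le> norm (1 + x) * norm (1 + x) powr a + 2 * (a / (real m + 1) * binom_tail a m)"
proof -
  have "(\<lambda>N. norm ((1 + x) * (binom_sum a N x - binom_sum a m x)))
      \<longlonglongrightarrow> norm ((1 + x) * ((1 + x) powr of_real a - binom_sum a m x))"
    by (intro tendsto_intros binom_sum_tendsto x)
  then have "norm ((1 + x) * ((1 + x) powr of_real a - binom_sum a m x))
      \<le> 2 * (a / (real m + 1) * binom_tail a m)"
    using norm_binom_sum_diff_le[OF a] x
    by (intro tendsto_upperbound[where F = sequentially])
       (auto intro!: eventually_sequentiallyI[of m])
  moreover have "norm ((1 + x) powr of_real a) = norm (1 + x) powr a"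
    by (simp add: norm_powr_real_powr')
  ultimately show ?thesis
    using norm_triangle_sub[of "(1 + x) * binom_sum a m x" "(1 + x) * (1 + x) powr of_real a"]
    by (simp add: norm_mult right_diff_distrib[symmetric] norm_minus_commute)
qed

lemma continuous_binom_sum: "isCont (binom_sum a m) x"
  unfolding binom_sum_def[abs_def] by (intro continuous_intros)

text \<open>Radial limit of the disc estimate along r x with r -> 1 from below: for fixed m both
  sides are continuous, so convergence of the series on the circle is never at issue.\<close>

lemma norm_binom_sum_le_far:
  assumes a: "0 < a" "a < 1" and x: "norm x = 1" "x \<noteq> -1"
  shows "norm (binom_sum a m x)
    \<le> norm (1 + x) powr a + 2 * (a / (real m + 1) * binom_tail a m) / norm (1 + x)"
proof -
  have nz: "1 + x \<noteq> 0" using x(2) by (simp add: add_eq_0_iff)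
  define f where "f r = of_real r * x" for r :: real
  have f: "(f \<longlongrightarrow> x) (at_left 1)"
    unfolding f_def by (auto intro!: tendsto_eq_intros)
  have B: "((\<lambda>r. binom_sum a m (f r)) \<longlongrightarrow> binom_sum a m x) (at_left 1)"
    by (rule isCont_tendsto_compose[OF continuous_binom_sum f])
  have "norm ((1 + x) * binom_sum a m x)
      \<le> norm (1 + x) * norm (1 + x) powr a + 2 * (a / (real m + 1) * binom_tail a m)"
  proof (rule tendsto_le)
    show "\<forall>\<^sub>F r in at_left 1. norm ((1 + f r) * binom_sum a m (f r))
      \<le> norm (1 + f r) * norm (1 + f r) powr a + 2 * (a / (real m + 1) * binom_tail a m)"
      unfolding eventually_at_left_field
      using x norm_binom_sum_mult_le_disc[OF a] by (intro exI[of _ 0]) (simp add: f_def norm_mult)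
    show "((\<lambda>r. norm ((1 + f r) * binom_sum a m (f r)))
      \<longlongrightarrow> norm ((1 + x) * binom_sum a m x)) (at_left 1)"
      by (intro tendsto_norm tendsto_mult tendsto_add tendsto_const f B)
    have "((\<lambda>r. norm (1 + f r)) \<longlongrightarrow> norm (1 + x)) (at_left 1)"
      by (intro tendsto_norm tendsto_add tendsto_const f)
    then show "((\<lambda>r. norm (1 + f r) * norm (1 + f r) powr a + 2 * (a / (real m + 1) * binom_tail a m))
      \<longlongrightarrow> norm (1 + x) * norm (1 + x) powr a + 2 * (a / (real m + 1) * binom_tail a m)) (at_left 1)"
      using nz by (intro tendsto_add tendsto_mult tendsto_powr tendsto_const) auto
  qed simp
  then have "norm (binom_sum a m x) \<le>
      (norm (1 + x) * norm (1 + x) powr a + 2 * (a / (real m + 1) * binom_tail a m)) / norm (1 + x)"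
    using nz by (simp add: norm_mult pos_le_divide_eq mult.commute)
  then show ?thesis using nz by (simp add: add_divide_distrib)
qed

section \<open>The lower bound at x = 1\<close>

lemma binom_sum_real_antimono:
  assumes a: "0 < a" "a < 1" and r: "0 \<le> r" "r \<le> (1::real)" and "odd m"
  shows "(\<Sum>k\<le>m + 2 * j. (a gchoose k) * r ^ k) \<le> (\<Sum>k\<le>m. (a gchoose k) * r ^ k)"
proof (induction j)
  case (Suc j)
  \<comment> \<open>Past an odd index the terms pair off to nonpositive contributions.\<close>
  define i where "i = m + 2 * j"
  have "odd i" using \<open>odd m\<close> by (simp add: i_def)
  have "a / (real (Suc i) + 1) * binom_tail a (Suc i) * r ^ Suc (Suc i)
      \<le> a / (real i + 1) * binom_tail a i * r ^ Suc i"
    using a r binom_tail_pos[of a i] binom_tail_pos[of a "Suc i"] binom_tail_antimono[of a i "Suc i"]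
    by (intro mult_mono divide_left_mono power_decreasing) auto
  then have "(a gchoose Suc i) * r ^ Suc i + (a gchoose Suc (Suc i)) * r ^ Suc (Suc i) \<le> 0"
    using \<open>odd i\<close> unfolding gbinomial_Suc_eq_binom_tail by simp
  then show ?case using Suc by (simp add: i_def add.assoc)
qed simp

text \<open>For 0 < r < 1 the sums with indices m + 2j stay below the one at m and converge to (1 +
  r)^a. Letting r -> 1 for the fixed polynomial gives the endpoint.\<close>

lemma binom_sum_one_ge:
  assumes a: "0 < a" "a < 1" and "odd m"
  shows "2 powr (a::real) \<le> (\<Sum>k\<le>m. a gchoose k)"
proof -
  define S where "S r N = (\<Sum>k\<le>N. (a gchoose k) * r ^ k)" for r :: real and N
  have disc: "(1 + r) powr a \<le> S r m" if r: "0 < r" "r < 1" for r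
  proof -
    have "S r \<longlonglongrightarrow> (1 + r) powr a"
      using gen_binomial_real[of r a] r by (simp add: sums_def_le S_def[abs_def])
    moreover have "strict_mono (\<lambda>j. m + 2 * j)" by (simp add: strict_mono_def)
    ultimately have "(\<lambda>j. S r (m + 2 * j)) \<longlonglongrightarrow> (1 + r) powr a"
      using LIMSEQ_subseq_LIMSEQ[of "S r" _ "\<lambda>j. m + 2 * j"] by (simp add: o_def)
    then show ?thesis
      using binom_sum_real_antimono[OF a _ _ \<open>odd m\<close>] r
      by (intro tendsto_upperbound[where F = sequentially]) (auto simp: S_def)
  qed
  have "(1 + 1) powr a \<le> S 1 m"
  proof (rule tendsto_le)
    show "\<forall>\<^sub>F r in at_left 1. (1 + r) powr a \<le> S r m"
      unfolding eventually_at_left_field using disc by (intro exI[of _ 0]) auto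
  qed (auto simp: S_def intro!: tendsto_eq_intros)
  then show ?thesis by (simp add: S_def)
qed

section \<open>Combining the two upper bounds\<close>

lemma powr_le_tangent_line:
  assumes "0 < a" "a < 1" "0 < (x::real)"
  shows "x powr a \<le> 1 + a * (x - 1)"
  \<comment> \<open>Weighted AM-GM for x and 1 with weights a and 1 - a.\<close>
  using Youngs_inequality_0[of a "1 - a" x 1] assms by (simp add: algebra_simps)

lemma norm_binom_sum_le_two_powr:
  assumes a: "0 < a" "a < 1" and x: "norm x = 1" "norm (1 + x) \<le> 1" and m: "m \<ge> 53"
  shows "norm (binom_sum a m x) \<le> 2 powr a"
proof -
  define t where "t = norm (1 + x)"
  define s where "s = (real m + 1) * t"
  have t: "0 \<le> t" "t \<le> 1" using x by (auto simp: t_def)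
  show ?thesis
  \<comment> \<open>The term -a/2 cancels the quadratic part of (1 - a)(1 - a/2), and 13/6 = 3/2 +
    2/3 leaves the slope 2/3, a rational lower bound for ln 2.\<close>
  proof (cases "s \<le> 13 / 6 - a / 2")
    case True
    have "norm (binom_sum a m x) \<le> binom_tail a m + a * (real m * t)"
      using norm_binom_sum_le_near[OF a x(1), of m] by (simp add: t_def mult.assoc)
    also have "\<dots> \<le> (1 - a) * (1 - a / 2) + a * (13 / 6 - a / 2)"
      using a m t True
      by (intro add_mono binom_tail_le mult_left_mono) (auto simp: s_def algebra_simps)
    also have "\<dots> = 1 + 2 / 3 * a" by (simp add: field_simps)
    also have "\<dots> \<le> 1 + ln 2 * a" using ln2_ge_two_thirds a by simp
    also have "\<dots> \<le> 2 powr a"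
      using exp_ge_add_one_self[of "a * ln 2"] by (simp add: powr_def mult.commute)
    finally show ?thesis .
  next
    case False
    then have s: "s > 0" using a by simp
    then have "t > 0" using t unfolding s_def by (simp add: zero_less_mult_iff)
    then have "x \<noteq> -1" by (auto simp: t_def)
    \<comment> \<open>With \<open>binom_tail a m\<close> at most 1 - a, this is what gives 2
      \<open>binom_tail a m\<close> / s <= 1 - t/2.\<close>
    have key: "4 * (1 - a) \<le> s * (2 - t)"
    proof (cases "s \<ge> 4")
      case True
      then have "4 * 1 \<le> s * (2 - t)" using t by (intro mult_mono) auto
      then show ?thesis using a by simp
    next
      case False
      \<comment> \<open>The size of m enters here: s < 4 and m + 1 >= 54 force t <= 4/54, hence 2 -
        t >= 52/27, and (13/6)(52/27) exceeds 4.\<close>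
      have "54 * t \<le> s" unfolding s_def using m t by (intro mult_right_mono) auto
      then have "t \<le> 2 / 27" using False by simp
      then have "(13 / 6 - a / 2) * (52 / 27) \<le> s * (2 - t)"
        using \<open>\<not> s \<le> 13 / 6 - a / 2\<close> a by (intro mult_mono) auto
      then show ?thesis using a by simp
    qed
    have "2 * (a / (real m + 1) * binom_tail a m) / t = a * (2 * binom_tail a m / s)"
      by (simp add: s_def)
    also have "\<dots> \<le> a * (1 - t / 2)"
    proof -
      have "binom_tail a m \<le> 1 - a"
        using binom_tail_antimono[of a 1 m] a m by (simp add: binom_tail_Suc) (simp add: binom_tail_def)
      then have "2 * binom_tail a m / s \<le> 1 - t / 2"
        using key s by (simp add: field_simps)
      from mult_left_mono[OF this, of a] a show ?thesis by simp
    qed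
    \<comment> \<open>The factor 2^a >= 1 is inserted to match the tangent to t^a at t = 2, which
      lies below 2^a by 2^a a (1 - t/2), exactly the room given to the tail.\<close>
    also have "\<dots> \<le> 2 powr a * (a * (1 - t / 2))"
      using a t ge_one_powr_ge_zero[of 2 a] mult_right_mono[of 1 "2 powr a" "a * (1 - t / 2)"] by simp
    finally have tail: "2 * (a / (real m + 1) * binom_tail a m) / t \<le> 2 powr a * (a * (1 - t / 2))" .
    have "t powr a = 2 powr a * (t / 2) powr a"
      using t by (simp add: powr_divide)
    also have "\<dots> \<le> 2 powr a * (1 + a * (t / 2 - 1))"
      using \<open>t > 0\<close> by (intro mult_left_mono powr_le_tangent_line a) auto
    finally have "t powr a \<le> 2 powr a * (1 + a * (t / 2 - 1))" .
    with tail have "t powr a + 2 * (a / (real m + 1) * binom_tail a m) / t \<le> 2 powr a"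
      by (simp add: algebra_simps)
    with norm_binom_sum_le_far[OF a x(1) \<open>x \<noteq> -1\<close>, of m] show ?thesis
      by (simp add: t_def)
  qed
qed

text \<open>The squared modulus is 2 + 2 cos \<theta>, and cos \<theta> <= -1/2 on these
  arcs.\<close>

lemma norm_one_plus_exp_le_one:
  assumes "\<theta> \<in> {- pi .. - (2 * pi / 3)} \<union> {2 * pi / 3 .. pi}"
  shows "norm (1 + exp (\<i> * complex_of_real \<theta>)) \<le> 1"
proof -
  have "cos \<theta> = cos \<bar>\<theta>\<bar>" by simp
  also have "\<dots> \<le> cos (2 * pi / 3)"
    using assms by (intro cos_monotone_0_pi_le) auto
  also have "\<dots> = - 1 / 2" by (simp add: cos_120)
  finally have "cos \<theta> \<le> - 1 / 2" .
  moreover have "(1 + cos \<theta>)\<^sup>2 + (sin \<theta>)\<^sup>2 = 2 + 2 * cos \<theta>"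
    using sin_cos_squared_add[of \<theta>] by (simp add: power2_eq_square algebra_simps)
  ultimately show ?thesis
    by (simp add: cmod_def Re_exp Im_exp)
qed

theorem theorem3:
  fixes n :: nat and \<alpha> :: real
  assumes "n \<ge> 27" and "\<alpha> \<in> {0<..<1}"
  shows "A_coeff (2 * n - 1) \<alpha> 1 \<in> \<real> \<and>
    (\<forall>\<theta> \<in> {- pi .. - (2 * pi / 3)} \<union> {2 * pi / 3 .. pi}.
       Re (A_coeff (2 * n - 1) \<alpha> 1) \<ge> cmod (A_coeff (2 * n - 1) \<alpha> (exp (\<i> * complex_of_real \<theta>))))"
proof -
  have one: "A_coeff (2 * n - 1) \<alpha> 1 = of_real (\<Sum>k\<le>2 * n - 1. \<alpha> gchoose k)"
    by (simp add: A_coeff_eq_binom_sum binom_sum_def)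
  \<comment> \<open>Since n >= 27, the truncated subtraction 2n - 1 is genuine, so the index is odd
    and at least 53.\<close>
  have "2 powr \<alpha> \<le> Re (A_coeff (2 * n - 1) \<alpha> 1)"
    unfolding one Re_complex_of_real using assms by (intro binom_sum_one_ge) auto
  moreover have "cmod (A_coeff (2 * n - 1) \<alpha> (exp (\<i> * complex_of_real \<theta>))) \<le> 2 powr \<alpha>"
    if "\<theta> \<in> {- pi .. - (2 * pi / 3)} \<union> {2 * pi / 3 .. pi}" for \<theta>
    unfolding A_coeff_eq_binom_sum using assms norm_one_plus_exp_le_one[OF that]
    by (intro norm_binom_sum_le_two_powr) auto
  moreover have "A_coeff (2 * n - 1) \<alpha> 1 \<in> \<real>"
    unfolding one by (rule Reals_of_real)
  ultimately show ?thesis by (meson order_trans)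
qed

end
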